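(* If $G$ is an almost bipartite non-König-Egerváry graph, then $\varrho_v(G)=n(G)$ if and only if $G=C_{2k+1}$ for some integer $k\geq 1$.
   Context: All graphs are finite, undirected, loopless, without multiple edges; $n(G)=|V(G)|$. $\alpha(G)$ is the maximum size of an independent set and $\mu(G)$ the maximum size of a matching. $G$ is a König-Egerváry graph if $\alpha(G)+\mu(G)=n(G)$. $G$ is almost bipartite if it has exactly one odd cycle. $\varrho_v(G)$ is the number of vertices $v\in V(G)$ such that $G-v$ is a König-Egerváry graph. $C_{m}$ denotes the cycle graph on $m$ vertices (equality of graphs is up to isomorphism). *)

theory Defs
  imports Main "HOL-Library.Disjoint_Sets"
begin

text \<open>
  A graph is a pair of a vertex set and a set of edges, an edge being the two-element set of its
  end vertices; hence loops, parallel edges and directions are excluded. The null graph is allowed.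
\<close>

type_synonym 'a graph = "'a set \<times> 'a set set"

abbreviation verts :: "'a graph \<Rightarrow> 'a set" where
  "verts G \<equiv> fst G"

abbreviation edges :: "'a graph \<Rightarrow> 'a set set" where
  "edges G \<equiv> snd G"

definition graph :: "'a graph \<Rightarrow> bool" where
  "graph G \<longleftrightarrow> finite (verts G) \<and> (\<forall>e\<in>edges G. e \<subseteq> verts G \<and> card e = 2)"

definition order :: "'a graph \<Rightarrow> nat" where
  "order G = card (verts G)"

definition independent :: "'a graph \<Rightarrow> 'a set \<Rightarrow> bool" where
  "independent G S \<longleftrightarrow> S \<subseteq> verts G \<and> (\<forall>u\<in>S. \<forall>v\<in>S. {u, v} \<notin> edges G)"

definition independence_number :: "'a graph \<Rightarrow> nat" where
  "independence_number G = Max {card S |S. independent G S}"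

definition matching :: "'a graph \<Rightarrow> 'a set set \<Rightarrow> bool" where
  "matching G M \<longleftrightarrow> M \<subseteq> edges G \<and> disjoint M"

definition matching_number :: "'a graph \<Rightarrow> nat" where
  "matching_number G = Max {card M |M. matching G M}"

definition koenig_egervary :: "'a graph \<Rightarrow> bool" where
  "koenig_egervary G \<longleftrightarrow> independence_number G + matching_number G = order G"

definition delete_vertex :: "'a graph \<Rightarrow> 'a \<Rightarrow> 'a graph" where
  "delete_vertex G v = (verts G - {v}, {e \<in> edges G. v \<notin> e})"

definition rho_v :: "'a graph \<Rightarrow> nat" where
  "rho_v G = card {v \<in> verts G. koenig_egervary (delete_vertex G v)}"

definition isomorphic :: "'a graph \<Rightarrow> 'b graph \<Rightarrow> bool" where
  "isomorphic G H \<longleftrightarrow> (\<exists>f. bij_betw f (verts G) (verts H) \<and> (`) f ` edges G = edges H)"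

text \<open>The cycle on \<open>m\<close> vertices; only meaningful for \<open>m \<ge> 3\<close>.\<close>

definition cycle_graph :: "nat \<Rightarrow> nat graph" where
  "cycle_graph m = ({..<m}, {{i, Suc i mod m} |i. i < m})"

definition subgraph :: "'a graph \<Rightarrow> 'a graph \<Rightarrow> bool" where
  "subgraph H G \<longleftrightarrow> graph H \<and> verts H \<subseteq> verts G \<and> edges H \<subseteq> edges G"

text \<open>
  Cycles of a graph are counted as subgraphs, so closed walks differing only in their starting
  point or orientation are the same cycle. Cycles need not be induced.
\<close>

definition odd_cycle_of :: "'a graph \<Rightarrow> 'a graph \<Rightarrow> bool" where
  "odd_cycle_of G C \<longleftrightarrow> subgraph C G \<and> (\<exists>k\<ge>1. isomorphic C (cycle_graph (2 * k + 1)))"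

definition almost_bipartite :: "'a graph \<Rightarrow> bool" where
  "almost_bipartite G \<longleftrightarrow> (\<exists>!C. odd_cycle_of G C)"

end

theory Submission
  imports Defs "HOL-Number_Theory.Cong"
begin

text \<open>
  In any graph an independent set and a matching together have at most as many members as there
  are vertices, because every edge of the matching has an end outside the independent set. Hence,
  when \<open>G\<close> is not Koenig-Egervary but every vertex-deleted subgraph is, deleting a vertex changes
  neither the independence number nor the matching number: every vertex is missed by some maximum
  matching.

  From this alone every edge \<open>{r, s}\<close> lies on an odd cycle, as in the construction of ear
  decompositions of factor-critical graphs. Take maximum matchings \<open>M\<close> and \<open>N\<close> that miss \<open>r\<close> and
  \<open>s\<close> respectively and follow the path from \<open>r\<close> that alternates between \<open>N\<close> and \<open>M\<close>. Neither
  matching can be enlarged, so the path has even length; and it must end in \<open>s\<close>, since otherwise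
  exchanging edges along it would yield a maximum matching that misses both \<open>r\<close> and \<open>s\<close>, to which
  \<open>{r, s}\<close> could be added. The path together with \<open>{r, s}\<close> is the odd cycle. This is
  \<open>alternating_path_or_better_matching\<close> and \<open>edge_on_odd_cycle\<close>.

  If \<open>G\<close> has only one odd cycle, that cycle therefore contains all the edges, and a vertex off it
  would be isolated. An isolated vertex can be added to a maximum independent set of the graph
  without it, which would make \<open>G\<close> Koenig-Egervary. So \<open>G\<close> is the cycle. Conversely an odd cycle
  minus a vertex is a path with an even number of vertices, which splits into matched pairs, and
  the first vertices of the pairs are independent.
\<close>

section \<open>Independent sets and matchings\<close>

lemma finite_edges: "graph G \<Longrightarrow> finite (edges G)"
  by (rule finite_subset[of _ "Pow (verts G)"]) (auto simp: graph_def)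

lemma finite_independent_cards: "graph G \<Longrightarrow> finite {card S |S. independent G S}"
proof -
  assume "graph G"
  then have "finite {S. independent G S}"
    using finite_subset[of "{S. independent G S}" "Pow (verts G)"]
    by (auto simp: independent_def graph_def)
  then show ?thesis by (rule finite_image_set)
qed

lemma finite_matching_cards: "graph G \<Longrightarrow> finite {card M |M. matching G M}"
proof -
  assume "graph G"
  then have "finite {M. matching G M}"
    using finite_subset[of "{M. matching G M}" "Pow (edges G)"]
    by (auto simp: matching_def finite_edges)
  then show ?thesis by (rule finite_image_set)
qed

lemma card_le_independence_number:
  "graph G \<Longrightarrow> independent G S \<Longrightarrow> card S \<le> independence_number G"
  unfolding independence_number_def by (intro Max_ge finite_independent_cards) auto

lemma card_le_matching_number:
  "graph G \<Longrightarrow> matching G M \<Longrightarrow> card M \<le> matching_number G"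
  unfolding matching_number_def by (intro Max_ge finite_matching_cards) auto

lemma obtain_maximum_independent:
  assumes "graph G"
  obtains S where "independent G S" "card S = independence_number G"
proof -
  have "independent G {}" by (simp add: independent_def)
  then have "{card S |S. independent G S} \<noteq> {}" by blast
  from Max_in[OF finite_independent_cards[OF assms] this] show ?thesis
    using that unfolding independence_number_def by auto
qed

lemma obtain_maximum_matching:
  assumes "graph G"
  obtains M where "matching G M" "card M = matching_number G"
proof -
  have "matching G {}" by (simp add: matching_def)
  then have "{card M |M. matching G M} \<noteq> {}" by blast
  from Max_in[OF finite_matching_cards[OF assms] this] show ?thesis
    using that unfolding matching_number_def by auto
qed

text \<open>Choosing for each edge of \<open>M\<close> an end outside \<open>S\<close> is injective, as \<open>M\<close> is disjoint.\<close>

lemma card_independent_plus_card_matching_le: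
  assumes G: "graph G" and S: "independent G S" and M: "matching G M"
  shows "card S + card M \<le> order G"
proof -
  have "\<forall>e\<in>M. \<exists>x. x \<in> e \<and> x \<in> verts G - S"
  proof
    fix e assume "e \<in> M"
    then have e: "e \<in> edges G" using M by (auto simp: matching_def)
    then obtain u v where "e = {u, v}" "{u, v} \<subseteq> verts G"
      using G by (metis card_2_iff graph_def)
    with e S show "\<exists>x. x \<in> e \<and> x \<in> verts G - S"
      unfolding independent_def by blast
  qed
  then obtain f where f: "\<And>e. e \<in> M \<Longrightarrow> f e \<in> e \<and> f e \<in> verts G - S" by metis
  have "inj_on f M"
  proof (rule inj_onI)
    fix a b assume ab: "a \<in> M" "b \<in> M" "f a = f b"
    show "a = b"
    proof (rule ccontr)
      assume "a \<noteq> b"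
      then have "a \<inter> b = {}" using M ab by (auto simp: matching_def dest: disjointD)
      with f ab show False by (metis disjoint_iff)
    qed
  qed
  moreover have fin: "finite (verts G)" using G by (simp add: graph_def)
  ultimately have "card M \<le> card (verts G - S)"
    using f by (intro card_inj_on_le) auto
  moreover have "S \<subseteq> verts G" using S by (simp add: independent_def)
  ultimately show ?thesis
    using fin card_mono[OF fin, of S] by (simp add: order_def card_Diff_subset finite_subset)
qed

lemma independence_plus_matching_number_le:
  assumes G: "graph G"
  shows "independence_number G + matching_number G \<le> order G"
proof -
  obtain S where "independent G S" "card S = independence_number G"
    using obtain_maximum_independent[OF G] .
  moreover obtain M where "matching G M" "card M = matching_number G"
    using obtain_maximum_matching[OF G] .
  ultimately show ?thesis using card_independent_plus_card_matching_le[OF G] by metis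
qed

lemma koenig_egervaryI:
  assumes "graph G" "independent G S" "matching G M" "order G \<le> card S + card M"
  shows "koenig_egervary G"
  using assms card_le_independence_number[of G S] card_le_matching_number[of G M]
    independence_plus_matching_number_le[of G]
  unfolding koenig_egervary_def by linarith

lemma graph_delete_vertex: "graph G \<Longrightarrow> graph (delete_vertex G v)"
  by (auto simp: graph_def delete_vertex_def)

lemma order_delete_vertex: "graph G \<Longrightarrow> v \<in> verts G \<Longrightarrow> order G = Suc (order (delete_vertex G v))"
  unfolding graph_def order_def delete_vertex_def using card_Suc_Diff1[of "verts G" v] by simp

lemma independent_delete_vertex:
  "independent (delete_vertex G v) S \<longleftrightarrow> independent G S \<and> v \<notin> S"
  by (auto simp: independent_def delete_vertex_def)

lemma matching_delete_vertex:
  "matching (delete_vertex G v) M \<longleftrightarrow> matching G M \<and> v \<notin> \<Union>M"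
  by (auto simp: matching_def delete_vertex_def)

section \<open>Graphs that are not Koenig-Egervary but whose vertex-deleted subgraphs are\<close>

text \<open>
  The sum of the two numbers is \<open>order G - 1\<close> for \<open>G - v\<close> and at most that for \<open>G\<close>, while neither
  number increases under deletion. So a maximum matching of \<open>G - v\<close> is still maximum in \<open>G\<close>.
\<close>

lemma obtain_maximum_matching_missing:
  assumes G: "graph G" "\<not> koenig_egervary G"
    and v: "v \<in> verts G" "koenig_egervary (delete_vertex G v)"
  obtains M where "matching G M" "v \<notin> \<Union>M" "card M = matching_number G"
proof -
  let ?H = "delete_vertex G v"
  have H: "graph ?H" using G by (simp add: graph_delete_vertex)
  obtain M where M: "matching ?H M" "card M = matching_number ?H"
    using obtain_maximum_matching[OF H] .
  obtain S where S: "independent ?H S" "card S = independence_number ?H"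
    using obtain_maximum_independent[OF H] .
  have "matching G M" "v \<notin> \<Union>M" using M by (auto simp: matching_delete_vertex)
  moreover have "independence_number ?H \<le> independence_number G"
    using S card_le_independence_number[OF G(1)] by (metis independent_delete_vertex)
  moreover have "matching_number ?H \<le> matching_number G"
    using M card_le_matching_number[OF G(1)] by (metis matching_delete_vertex)
  ultimately show ?thesis
    using that M(2) v(2) G(2) independence_plus_matching_number_le[OF G(1)]
      order_delete_vertex[OF G(1) v(1)]
    unfolding koenig_egervary_def by fastforce
qed

text \<open>
  A maximum independent set of \<open>G - v\<close> stays independent when an isolated vertex \<open>v\<close> is added, so
  both sides of the Koenig-Egervary equation grow by one.
\<close>

lemma not_isolated:
  assumes G: "graph G" "\<not> koenig_egervary G"
    and v: "v \<in> verts G" "koenig_egervary (delete_vertex G v)"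
  shows "v \<in> \<Union>(edges G)"
proof (rule ccontr)
  assume iso: "v \<notin> \<Union>(edges G)"
  let ?H = "delete_vertex G v"
  have H: "graph ?H" using G by (simp add: graph_delete_vertex)
  obtain M where M: "matching ?H M" "card M = matching_number ?H"
    using obtain_maximum_matching[OF H] .
  obtain S where S: "independent ?H S" "card S = independence_number ?H"
    using obtain_maximum_independent[OF H] .
  have "independent G S" "v \<notin> S" using S by (auto simp: independent_delete_vertex)
  then have "independent G (insert v S)" using iso v unfolding independent_def by auto
  moreover have "card (insert v S) = Suc (card S)"
    using \<open>v \<notin> S\<close> \<open>independent G S\<close> G
    by (metis card_insert_disjoint finite_subset graph_def independent_def)
  moreover have "matching G M" using M by (auto simp: matching_delete_vertex)
  ultimately have "koenig_egervary G"
    using M S v order_delete_vertex[OF G(1) v(1)] G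
    by (intro koenig_egervaryI[of G "insert v S" M]) (auto simp: koenig_egervary_def)
  with G show False by simp
qed

section \<open>Cyclic enumerations\<close>

text \<open>
  Cycle graphs are handled through an enumeration of the vertices along the cycle that is periodic
  on all natural numbers; moving its starting point is then a shift of the argument.
\<close>

definition cyclic_enumeration :: "(nat \<Rightarrow> 'a) \<Rightarrow> nat \<Rightarrow> 'a graph \<Rightarrow> bool" where
  "cyclic_enumeration h m G \<longleftrightarrow>
     verts G = range h \<and> edges G = range (\<lambda>i. {h i, h (Suc i)}) \<and>
     (\<forall>i j. h i = h j \<longleftrightarrow> i mod m = j mod m)"

lemma isomorphic_cycle_graph_if_cyclic_enumeration:
  assumes h: "cyclic_enumeration h m G" and m: "m > 0"
  shows "isomorphic G (cycle_graph m)"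
proof -
  have heq: "h i = h j \<longleftrightarrow> i mod m = j mod m" for i j
    using h by (simp add: cyclic_enumeration_def)
  define f where "f = inv_into {..<m} h"
  have inj: "inj_on h {..<m}" by (auto simp: inj_on_def heq)
  have img: "h ` {..<m} = verts G"
  proof -
    have "h i \<in> h ` {..<m}" for i
      using m heq[of i "i mod m"] by (intro image_eqI[of _ _ "i mod m"]) auto
    then show ?thesis using h by (auto simp: cyclic_enumeration_def)
  qed
  have fh: "f (h i) = i mod m" for i
  proof -
    have "f (h (i mod m)) = i mod m"
      unfolding f_def using m by (intro inv_into_f_f[OF inj]) auto
    then show ?thesis using heq[of i "i mod m"] by simp
  qed
  have "bij_betw f (verts G) {..<m}"
    unfolding f_def using inj img by (intro bij_betw_inv_into) (simp add: bij_betw_def)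
  moreover have "(`) f ` edges G = {{i, Suc i mod m} |i. i < m}"
  proof -
    have "(`) f ` edges G = range (\<lambda>i. {i mod m, Suc i mod m})"
      using h by (simp add: cyclic_enumeration_def image_image fh)
    also have "\<dots> = {{i, Suc i mod m} |i. i < m}"
    proof (intro equalityI subsetI)
      fix e assume "e \<in> range (\<lambda>i. {i mod m, Suc i mod m})"
      then obtain i where "e = {i mod m, Suc (i mod m) mod m}" by (auto simp: mod_Suc_eq)
      then show "e \<in> {{i, Suc i mod m} |i. i < m}" using m mod_less_divisor by blast
    next
      fix e assume "e \<in> {{i, Suc i mod m} |i. i < m}"
      then obtain i where "i < m" "e = {i, Suc i mod m}" by blast
      then show "e \<in> range (\<lambda>i. {i mod m, Suc i mod m})" by (intro image_eqI[of _ _ i]) auto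
    qed
    finally show ?thesis .
  qed
  ultimately show ?thesis
    unfolding isomorphic_def cycle_graph_def by auto
qed

lemma cyclic_enumeration_if_isomorphic_cycle_graph:
  assumes G: "graph G" and iso: "isomorphic G (cycle_graph m)" and m: "m > 0"
  obtains h where "cyclic_enumeration h m G"
proof -
  obtain f where f: "bij_betw f (verts G) {..<m}"
    and fe: "(`) f ` edges G = {{i, Suc i mod m} |i. i < m}"
    using iso unfolding isomorphic_def cycle_graph_def by auto
  define g where "g = inv_into (verts G) f"
  have g: "bij_betw g {..<m} (verts G)" unfolding g_def using f by (rule bij_betw_inv_into)
  have gf: "g ` f ` e = e" if "e \<in> edges G" for e
  proof -
    have "e \<subseteq> verts G" using G that by (auto simp: graph_def)
    then have "g (f x) = x" if "x \<in> e" for x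
      unfolding g_def using bij_betw_inv_into_left[OF f] that by blast
    then show ?thesis by (simp add: image_image)
  qed
  have "(`) g ` (`) f ` edges G = (\<lambda>e. g ` f ` e) ` edges G" by (rule image_image)
  also have "\<dots> = edges G" using gf by simp
  finally have ge: "edges G = (`) g ` {{i, Suc i mod m} |i. i < m}" using fe by simp
  define h where "h i = g (i mod m)" for i
  have "verts G = range h"
  proof -
    have "range (\<lambda>i. i mod m) = {..<m}"
    proof (intro equalityI subsetI)
      fix i assume "i \<in> {..<m}"
      then show "i \<in> range (\<lambda>i. i mod m)" by (intro image_eqI[of _ _ i]) auto
    qed (use m in auto)
    moreover have "range h = g ` range (\<lambda>i. i mod m)" by (auto simp: h_def)
    ultimately show ?thesis using g by (simp add: bij_betw_def)
  qed
  moreover have "edges G = range (\<lambda>i. {h i, h (Suc i)})"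
  proof (intro equalityI subsetI)
    fix e assume "e \<in> edges G"
    then obtain i where "i < m" "e = {g i, g (Suc i mod m)}" using ge by auto
    then show "e \<in> range (\<lambda>i. {h i, h (Suc i)})" by (intro image_eqI[of _ _ i]) (auto simp: h_def)
  next
    fix e assume "e \<in> range (\<lambda>i. {h i, h (Suc i)})"
    then obtain i where "e = g ` {i mod m, Suc (i mod m) mod m}"
      by (auto simp: h_def mod_Suc_eq)
    then show "e \<in> edges G" unfolding ge using m mod_less_divisor by blast
  qed
  moreover have "h i = h j \<longleftrightarrow> i mod m = j mod m" for i j
  proof -
    have "inj_on g {..<m}" using g by (simp add: bij_betw_def)
    then show ?thesis using m by (simp add: h_def inj_on_eq_iff)
  qed
  ultimately show ?thesis using that unfolding cyclic_enumeration_def by blast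
qed

lemma cyclic_enumeration_shift:
  assumes h: "cyclic_enumeration h m G" and m: "m > 0"
  shows "cyclic_enumeration (\<lambda>i. h (i + c)) m G"
proof -
  have heq: "h i = h j \<longleftrightarrow> i mod m = j mod m" for i j
    using h by (simp add: cyclic_enumeration_def)
  \<comment> \<open>Every index \<open>i\<close> is congruent to a shifted one, as \<open>c \<le> m * c\<close>.\<close>
  have shifted: "h i = h (i + (m * c - c) + c)" "h (Suc i) = h (Suc (i + (m * c - c) + c))" for i
  proof -
    have "c \<le> m * c" using m by simp
    then have "i + (m * c - c) + c = i + m * c" by linarith
    then show "h i = h (i + (m * c - c) + c)" "h (Suc i) = h (Suc (i + (m * c - c) + c))"
      unfolding heq by (metis mod_mult_self2, metis add_Suc mod_mult_self2)
  qed
  have "range h = range (\<lambda>i. h (i + c))" using shifted(1) by blast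
  moreover have "range (\<lambda>i. {h i, h (Suc i)}) = range (\<lambda>i. {h (i + c), h (Suc i + c)})"
  proof (intro equalityI subsetI)
    fix e assume "e \<in> range (\<lambda>i. {h i, h (Suc i)})"
    then obtain i where "e = {h i, h (Suc i)}" by blast
    then show "e \<in> range (\<lambda>i. {h (i + c), h (Suc i + c)})"
      using shifted[of i] by (intro image_eqI[of _ _ "i + (m * c - c)"]) auto
  qed auto
  moreover have "(i + c) mod m = (j + c) mod m \<longleftrightarrow> i mod m = j mod m" for i j
    using cong_add_rcancel_nat[of i c j m] by (simp add: cong_def)
  ultimately show ?thesis using h unfolding cyclic_enumeration_def by simp
qed

section \<open>Odd cycles minus a vertex\<close>

text \<open>
  With the enumeration started just behind the deleted vertex, the remaining path is
  \<open>h 0, \<dots>, h (2 * k - 1)\<close>.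
\<close>

lemma koenig_egervary_odd_cycle_delete_vertex:
  assumes G: "graph G" and iso: "isomorphic G (cycle_graph (2 * k + 1))" and v: "v \<in> verts G"
  shows "koenig_egervary (delete_vertex G v)"
proof -
  let ?m = "2 * k + 1"
  obtain h0 where h0: "cyclic_enumeration h0 ?m G"
    using cyclic_enumeration_if_isomorphic_cycle_graph[OF G iso] by auto
  obtain j where j: "v = h0 j" using v h0 by (auto simp: cyclic_enumeration_def)
  define h where "h i = h0 (i + Suc j)" for i
  have h: "cyclic_enumeration h ?m G"
    unfolding h_def by (rule cyclic_enumeration_shift[OF h0]) simp
  have vh: "v = h (2 * k)"
  proof -
    have "2 * k + Suc j = ?m + j" by simp
    then have "(2 * k + Suc j) mod ?m = j mod ?m" by (simp only: mod_add_self1)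
    then have "h0 (2 * k + Suc j) = h0 j" using h0 by (simp only: cyclic_enumeration_def)
    then show ?thesis by (simp only: j h_def)
  qed
  have vertsG: "verts G = range h" and edgesG: "edges G = range (\<lambda>i. {h i, h (Suc i)})"
    and heq: "h i = h j \<longleftrightarrow> i mod ?m = j mod ?m" for i j
    using h by (simp_all only: cyclic_enumeration_def)
  have inj: "h i = h j \<longleftrightarrow> i = j" if "i < ?m" "j < ?m" for i j
    using that heq[of i j] by simp
  have edge: "\<exists>a<?m. e = {h a, h (Suc a mod ?m)}" if "e \<in> edges G" for e
  proof -
    from that obtain i where "e = {h i, h (Suc i)}" unfolding edgesG by auto
    moreover have "h i = h (i mod ?m)" "h (Suc i) = h (Suc (i mod ?m) mod ?m)"
      unfolding heq by (simp_all add: mod_Suc_eq)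
    ultimately show ?thesis by (intro exI[of _ "i mod ?m"]) simp
  qed
  define S where "S = (\<lambda>t. h (2 * t)) ` {..<k}"
  define M where "M = (\<lambda>t. {h (2 * t), h (Suc (2 * t))}) ` {..<k}"
  have "card S = k"
    unfolding S_def by (subst card_image) (auto simp: inj_on_def inj)
  have "card M = k"
  proof -
    have "inj_on (\<lambda>t. {h (2 * t), h (Suc (2 * t))}) {..<k}"
    proof (rule inj_onI)
      fix s t assume st: "s \<in> {..<k}" "t \<in> {..<k}"
        and "{h (2 * s), h (Suc (2 * s))} = {h (2 * t), h (Suc (2 * t))}"
      then have "h (2 * s) = h (2 * t) \<or> h (2 * s) = h (Suc (2 * t))" by blast
      then show "s = t" using st by (simp add: inj) presburger
    qed
    then show ?thesis by (simp add: M_def card_image)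
  qed
  have "independent (delete_vertex G v) S"
    unfolding independent_delete_vertex
  proof
    show "v \<notin> S" unfolding vh S_def by (auto simp: inj)
    have "{h (2 * s), h (2 * t)} \<notin> edges G" if st: "s < k" "t < k" for s t
    proof
      assume "{h (2 * s), h (2 * t)} \<in> edges G"
      from edge[OF this] obtain a where a: "a < ?m"
        and "{h (2 * s), h (2 * t)} = {h a, h (Suc a mod ?m)}" by blast
      then have "h (2 * s) = h a \<and> h (2 * t) = h (Suc a mod ?m) \<or>
          h (2 * s) = h (Suc a mod ?m) \<and> h (2 * t) = h a"
        unfolding doubleton_eq_iff by blast
      then have "2 * s = a \<and> 2 * t = Suc a mod ?m \<or> 2 * s = Suc a mod ?m \<and> 2 * t = a"
        using st a by (simp add: inj)
      moreover from this have "a < 2 * k" using st by auto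
      then have "Suc a mod ?m = Suc a" by simp
      ultimately have "2 * s = a \<and> 2 * t = Suc a \<or> 2 * s = Suc a \<and> 2 * t = a" by simp
      then show False by presburger
    qed
    moreover have "S \<subseteq> verts G" unfolding S_def vertsG by blast
    ultimately show "independent G S" by (auto simp: independent_def S_def)
  qed
  moreover have "matching (delete_vertex G v) M"
    unfolding matching_delete_vertex
  proof
    show "v \<notin> \<Union>M" unfolding vh M_def by (auto simp: inj)
    have "disjoint M"
    proof (rule disjointI)
      fix a b assume "a \<in> M" "b \<in> M" "a \<noteq> b"
      then obtain s t where st: "s < k" "t < k" "s \<noteq> t"
        and ab: "a = {h (2 * s), h (Suc (2 * s))}" "b = {h (2 * t), h (Suc (2 * t))}"
        unfolding M_def by auto
      have "2 * s \<noteq> Suc (2 * t)" "Suc (2 * s) \<noteq> 2 * t" by presburger+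
      then show "a \<inter> b = {}" using st unfolding ab by (simp add: inj)
    qed
    moreover have "M \<subseteq> edges G" unfolding M_def edgesG by blast
    ultimately show "matching G M" by (simp add: matching_def)
  qed
  moreover have "order (delete_vertex G v) = 2 * k"
  proof -
    have "order G = ?m"
      using iso unfolding isomorphic_def order_def cycle_graph_def by (auto dest: bij_betw_same_card)
    then show ?thesis using order_delete_vertex[OF G v] by simp
  qed
  ultimately show ?thesis
    using \<open>card S = k\<close> \<open>card M = k\<close>
    by (intro koenig_egervaryI[OF graph_delete_vertex[OF G]]) auto
qed

section \<open>Every edge lies on an odd cycle\<close>

lemma odd_cycle_of_closed_path:
  assumes G: "graph G" and p: "distinct p" "successively (\<lambda>x y. {x, y} \<in> edges G) p"
    and len: "odd (length p)" "length p \<noteq> 1" and closed: "{last p, hd p} \<in> edges G"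
  obtains C where "odd_cycle_of G C" "{last p, hd p} \<in> edges C"
proof -
  define m where "m = length p"
  define h where "h i = p ! (i mod m)" for i
  define C where "C = (range h, range (\<lambda>i. {h i, h (Suc i)}))"
  obtain k where k: "m = 2 * k + 1" "k \<ge> 1"
    using len unfolding m_def by (metis One_nat_def Suc_leI add.commute mult_0_right neq0_conv oddE plus_nat.add_0)
  have m: "m > 0" "p \<noteq> []" using k unfolding m_def by auto
  have "cyclic_enumeration h m C"
    using p m unfolding cyclic_enumeration_def C_def h_def
    by (auto simp: nth_eq_iff_index_eq m_def)
  then have "isomorphic C (cycle_graph (2 * k + 1))"
    using isomorphic_cycle_graph_if_cyclic_enumeration m k by metis
  moreover have "edges C \<subseteq> edges G"
  proof
    fix e assume "e \<in> edges C"
    then obtain i where i: "e = {h i, h (Suc i)}" by (auto simp: C_def)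
    define a where "a = i mod m"
    have a: "a < m" "e = {p ! a, p ! (Suc a mod m)}"
      using m i by (auto simp: a_def h_def mod_Suc_eq)
    show "e \<in> edges G"
    proof (cases "Suc a < m")
      case True
      with a p(2) show ?thesis by (simp add: successively_conv_nth m_def)
    next
      case False
      with a have "Suc a = m" by linarith
      then have "a = m - 1" "Suc a mod m = 0" by auto
      then show ?thesis using a closed m by (simp add: last_conv_nth hd_conv_nth m_def)
    qed
  qed
  moreover have "{last p, hd p} \<in> edges C"
  proof -
    have "h (m - 1) = last p" "h (Suc (m - 1)) = hd p"
      using m by (simp_all add: h_def last_conv_nth hd_conv_nth m_def)
    then show ?thesis unfolding C_def by (auto intro!: image_eqI[of _ _ "m - 1"])
  qed
  moreover have "verts C \<subseteq> verts G"
  proof -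
    have "h i \<in> \<Union>(edges C)" for i unfolding C_def by auto
    moreover have "\<Union>(edges G) \<subseteq> verts G" using G by (auto simp: graph_def)
    ultimately have "h i \<in> verts G" for i using \<open>edges C \<subseteq> edges G\<close> by blast
    then show ?thesis by (auto simp: C_def)
  qed
  moreover have "graph C"
  proof -
    have "finite (verts C)" using \<open>verts C \<subseteq> verts G\<close> G by (auto simp: graph_def intro: finite_subset)
    moreover have "e \<subseteq> verts C" if "e \<in> edges C" for e using that by (auto simp: C_def)
    ultimately show ?thesis using \<open>edges C \<subseteq> edges G\<close> G unfolding graph_def by blast
  qed
  ultimately show ?thesis
    using that k unfolding odd_cycle_of_def subgraph_def by blast
qed

lemma disjoint_insert_edge:
  "disjoint M \<Longrightarrow> x \<notin> \<Union>M \<Longrightarrow> y \<notin> \<Union>M \<Longrightarrow> disjoint (insert {x, y} M)"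
  by (auto simp: disjoint_def)

lemma obtain_mate:
  assumes "x \<in> \<Union>N" "\<forall>e\<in>N. card e = 2"
  obtains y where "{x, y} \<in> N" "x \<noteq> y"
proof -
  obtain e where "e \<in> N" "x \<in> e" using assms by blast
  moreover from this obtain a b where "e = {a, b}" "a \<noteq> b" using assms by (metis card_2_iff)
  ultimately show ?thesis using that by (metis empty_iff insert_commute insert_iff)
qed

lemma not_in_Union_remove:
  "disjoint M \<Longrightarrow> e \<in> M \<Longrightarrow> x \<in> e \<Longrightarrow> x \<notin> \<Union>(M - {e})"
  by (auto simp: disjoint_def)

text \<open>
  The component of \<open>r\<close> in the union of the two matchings is a path, and its first two edges
  \<open>{r, y} \<in> N\<close> and \<open>{y, z} \<in> M\<close> can be split off: the remaining matchings avoid \<open>r\<close> and \<open>y\<close>, and \<open>M\<close>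
  without \<open>{y, z}\<close> misses \<open>z\<close>, which takes the place of \<open>r\<close>. Restricting the better matching to
  edges of \<open>M \<union> N\<close> makes sure that it can be extended by \<open>{y, z}\<close> or \<open>{r, y}\<close> again.
\<close>

lemma alternating_path_or_better_matching:
  assumes "finite M" "finite N" "disjoint M" "disjoint N" "\<forall>e\<in>M \<union> N. card e = 2"
    and "card M = card N" "r \<notin> \<Union>M" "s \<notin> \<Union>N" "r \<noteq> s"
  shows "(\<exists>p. distinct p \<and> odd (length p) \<and> length p \<noteq> 1 \<and> hd p = r \<and> last p = s \<and>
            set p \<subseteq> \<Union>(M \<union> N) \<and> successively (\<lambda>x y. {x, y} \<in> M \<union> N) p) \<or>
         (\<exists>K \<subseteq> M \<union> N. disjoint K \<and> 
            (card M < card K \<or> card M = card K \<and> r \<notin> \<Union>K \<and> s \<notin> \<Union>K))"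
    (is "?path M N r \<or> ?better M N r")
  using assms
proof (induction "card N" arbitrary: M N r)
  case 0
  then show ?case by auto
next
  case (Suc n)
  show ?case
  proof (cases "r \<in> \<Union>N")
    case False
    then have "?better M N r" using Suc.prems by (intro exI[of _ N]) auto
    then show ?thesis ..
  next
    case True
    then obtain y where y: "{r, y} \<in> N" "r \<noteq> y" using Suc.prems(5) obtain_mate[of r N] by blast
    have ys: "y \<noteq> s" using y Suc.prems by auto
    show ?thesis
    proof (cases "y \<in> \<Union>M")
      case False
      have "{r, y} \<notin> M" using Suc.prems by auto
      then have "?better M N r"
        using Suc.prems y False
        by (intro exI[of _ "insert {r, y} M"]) (auto intro!: disjoint_insert_edge)
      then show ?thesis ..
    next
      case True
      then obtain z where z: "{y, z} \<in> M" "y \<noteq> z" using Suc.prems(5) obtain_mate[of y M] by blast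
      have zr: "z \<noteq> r" using z Suc.prems by auto
      define M' where "M' = M - {{y, z}}"
      define N' where "N' = N - {{r, y}}"
      have sub: "M' \<subseteq> M" "N' \<subseteq> N" by (auto simp: M'_def N'_def)
      have avoid: "r \<notin> \<Union>(M' \<union> N')" "y \<notin> \<Union>(M' \<union> N')" "z \<notin> \<Union>M'"
      proof -
        have "r \<notin> \<Union>N'" "y \<notin> \<Union>N'" "y \<notin> \<Union>M'" "z \<notin> \<Union>M'"
          unfolding M'_def N'_def
          using not_in_Union_remove[OF \<open>disjoint N\<close> y(1)] not_in_Union_remove[OF \<open>disjoint M\<close> z(1)]
          by blast+
        moreover have "r \<notin> \<Union>M'" using Suc.prems sub by blast
        ultimately show "r \<notin> \<Union>(M' \<union> N')" "y \<notin> \<Union>(M' \<union> N')" "z \<notin> \<Union>M'" by auto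
      qed
      have edges: "{r, y} \<in> M \<union> N" "{y, z} \<in> M \<union> N" using y z by auto
      have cards: "card M = Suc (card M')" "card N = Suc (card N')"
        using card_Suc_Diff1[OF \<open>finite M\<close> z(1)] card_Suc_Diff1[OF \<open>finite N\<close> y(1)]
        unfolding M'_def N'_def by simp_all
      show ?thesis
      proof (cases "z = s")
        case True
        have "?path M N r"
          using y z zr ys True edges by (intro exI[of _ "[r, y, s]"]) auto
        then show ?thesis ..
      next
        case False
        have "?path M' N' z \<or> ?better M' N' z"
        proof (rule Suc.hyps(1))
          show "n = card N'" "card M' = card N'" using Suc.hyps(2) Suc.prems cards by auto
          show "finite M'" "finite N'" using Suc.prems sub by (auto intro: finite_subset)
          show "disjoint M'" "disjoint N'" using Suc.prems sub by (auto intro: pairwise_subset)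
          show "\<forall>e\<in>M' \<union> N'. card e = 2" "s \<notin> \<Union>N'" using Suc.prems sub by blast+
          show "z \<notin> \<Union>M'" "z \<noteq> s" using avoid False by auto
        qed
        then show ?thesis
        proof
          assume "?path M' N' z"
          then obtain p where p: "distinct p" "odd (length p)" "length p \<noteq> 1" "hd p = z" "last p = s"
            "set p \<subseteq> \<Union>(M' \<union> N')" "successively (\<lambda>x y. {x, y} \<in> M' \<union> N') p" by blast
          have "r \<notin> set p" "y \<notin> set p" using p avoid by blast+
          moreover have "successively (\<lambda>x y. {x, y} \<in> M \<union> N) p"
            using p(7) sub by (auto elim: successively_mono)
          moreover have "p \<noteq> []" using p by auto
          moreover have "set p \<subseteq> \<Union>(M \<union> N)" using p(6) sub by blast
          ultimately have "?path M N r"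
            using p(1-5) y edges by (intro exI[of _ "r # y # p"]) (auto simp: successively_Cons)
          then show ?thesis ..
        next
          assume "?better M' N' z"
          then obtain K where K: "K \<subseteq> M' \<union> N'" "disjoint K"
            and better: "card M' < card K \<or> card M' = card K \<and> z \<notin> \<Union>K \<and> s \<notin> \<Union>K" by blast
          have finK: "finite K" using K Suc.prems sub by (meson finite_UnI finite_subset)
          have rK: "r \<notin> \<Union>K" "y \<notin> \<Union>K" using K avoid by blast+
          from better have "?better M N r"
          proof
            assume "card M' < card K"
            moreover have "{r, y} \<notin> K" using rK by auto
            ultimately show ?thesis
              using K sub edges rK cards finK
              by (intro exI[of _ "insert {r, y} K"] conjI disjoint_insert_edge) auto
          next
            assume "card M' = card K \<and> z \<notin> \<Union>K \<and> s \<notin> \<Union>K"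
            moreover from this have "{y, z} \<notin> K" by auto
            ultimately show ?thesis
              using K sub edges rK cards finK zr y ys False
              by (intro exI[of _ "insert {y, z} K"] conjI disjoint_insert_edge disjI2) auto
          qed
          then show ?thesis ..
        qed
      qed
    qed
  qed
qed

lemma edge_on_odd_cycle:
  assumes G: "graph G"
    and miss: "\<And>v. v \<in> verts G \<Longrightarrow> \<exists>M. matching G M \<and> v \<notin> \<Union>M \<and> card M = matching_number G"
    and e: "e \<in> edges G"
  obtains C where "odd_cycle_of G C" "e \<in> edges C"
proof -
  obtain r s where rs: "e = {s, r}" "r \<noteq> s" "r \<in> verts G" "s \<in> verts G"
    using G e by (metis card_2_iff graph_def insert_subset)
  obtain M where M: "matching G M" "r \<notin> \<Union>M" "card M = matching_number G" using miss rs by blast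
  obtain N where N: "matching G N" "s \<notin> \<Union>N" "card N = matching_number G" using miss rs by blast
  have sub: "M \<union> N \<subseteq> edges G" and "disjoint M" "disjoint N"
    using M N by (auto simp: matching_def)
  moreover from sub have "finite M" "finite N" using finite_edges[OF G] by (auto intro: finite_subset)
  moreover have "\<forall>e\<in>M \<union> N. card e = 2" using sub G by (auto simp: graph_def)
  ultimately consider
      (path) p where "distinct p" "odd (length p)" "length p \<noteq> 1" "hd p = r" "last p = s"
        "successively (\<lambda>x y. {x, y} \<in> M \<union> N) p"
    | (better) K where "K \<subseteq> M \<union> N" "disjoint K"
        "card M < card K \<or> card M = card K \<and> r \<notin> \<Union>K \<and> s \<notin> \<Union>K"
    using alternating_path_or_better_matching[of M N r s] M N rs by auto
  then show ?thesis
  proof cases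
    case path
    have "successively (\<lambda>x y. {x, y} \<in> edges G) p"
      using path(6) sub by (auto elim: successively_mono)
    then show ?thesis
      using odd_cycle_of_closed_path[OF G, of p] path e rs that by metis
  next
    case better
    have "matching G K" using better sub by (auto simp: matching_def)
    then have "card K \<le> card M" using card_le_matching_number[OF G] M by simp
    with better have K: "card K = card M" "r \<notin> \<Union>K" "s \<notin> \<Union>K" by auto
    have "matching G (insert e K)"
      using better e rs K \<open>matching G K\<close> by (auto simp: matching_def intro!: disjoint_insert_edge)
    then have "card (insert e K) \<le> card M" using card_le_matching_number[OF G] M by simp
    moreover have "finite K" using \<open>matching G K\<close> finite_edges[OF G] by (auto simp: matching_def intro: finite_subset)
    moreover have "e \<notin> K" using K rs by auto
    ultimately show ?thesis using K by simp
  qed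
qed

section \<open>The characterisation of odd cycles\<close>

lemma rho_v_eq_order_iff:
  "graph G \<Longrightarrow> rho_v G = order G \<longleftrightarrow> (\<forall>v\<in>verts G. koenig_egervary (delete_vertex G v))"
proof -
  assume "graph G"
  then have "finite (verts G)" by (simp add: graph_def)
  from card_subset_eq[OF this, of "{v \<in> verts G. koenig_egervary (delete_vertex G v)}"]
  have "rho_v G = order G \<longleftrightarrow> {v \<in> verts G. koenig_egervary (delete_vertex G v)} = verts G"
    unfolding rho_v_def order_def by auto
  then show ?thesis by blast
qed

theorem proposition3p13:
  fixes G :: "'a graph"
  assumes "graph G"
    and "almost_bipartite G"
    and "\<not> koenig_egervary G"
  shows "rho_v G = order G \<longleftrightarrow> (\<exists>k\<ge>1. isomorphic G (cycle_graph (2 * k + 1)))"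
proof
  assume "rho_v G = order G"
  then have KE: "koenig_egervary (delete_vertex G v)" if "v \<in> verts G" for v
    using that assms by (simp add: rho_v_eq_order_iff)
  obtain C where C: "odd_cycle_of G C" and unique: "\<And>C'. odd_cycle_of G C' \<Longrightarrow> C' = C"
    using assms unfolding almost_bipartite_def by blast
  have sub: "graph C" "verts C \<subseteq> verts G" "edges C \<subseteq> edges G"
    using C by (auto simp: odd_cycle_of_def subgraph_def)
  have miss: "\<exists>M. matching G M \<and> v \<notin> \<Union>M \<and> card M = matching_number G" if "v \<in> verts G" for v
    using obtain_maximum_matching_missing[OF assms(1,3) that KE[OF that]] by blast
  have "edges G \<subseteq> edges C"
    using edge_on_odd_cycle[OF assms(1) miss] unique by blast
  then have edges: "edges G = edges C" using sub by blast
  have "verts G \<subseteq> \<Union>(edges C)"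
    using not_isolated[OF assms(1,3) _ KE] edges by auto
  moreover have "\<Union>(edges C) \<subseteq> verts C" using sub by (auto simp: graph_def)
  ultimately have "verts G = verts C" using sub by blast
  with edges have "G = C" by (simp add: prod_eq_iff)
  with C show "\<exists>k\<ge>1. isomorphic G (cycle_graph (2 * k + 1))"
    by (auto simp: odd_cycle_of_def)
next
  assume "\<exists>k\<ge>1. isomorphic G (cycle_graph (2 * k + 1))"
  then show "rho_v G = order G"
    using rho_v_eq_order_iff koenig_egervary_odd_cycle_delete_vertex assms(1) by metis
qed

end
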